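(* Let $\alpha_+:\mathrm{QSym}\to\mathrm{QSym}$ be the linear map with $\alpha_+(M_I)=M_{I\sqcup(1)}$ for every composition $I$ (where $I\sqcup(1)$ appends a final part $1$). Then for every monomial $u$ of $\mathcal{H}_K$ (a forest of rooted trees, including $u=1$), $Z^*(B_+(u))=\alpha_+(Z^*(u))$. Moreover, if $f:\mathcal{H}_K\to\mathrm{QSym}$ is any algebra homomorphism with $f(B_+(u))=\alpha_+(f(u))$ for every monomial $u$ of $\mathcal{H}_K$, then $f=Z^*$.
   Context: $k$ is a field of characteristic $0$. $\mathrm{QSym}$ is the algebra of quasi-symmetric functions over $k$ (formal power series of bounded degree in $x_1,x_2,\dots$ whose coefficients of $x_{n_1}^{i_1}\cdots x_{n_k}^{i_k}$ and $x_1^{i_1}\cdots x_k^{i_k}$ agree whenever $n_1<\dots<n_k$), with basis $M_I=\sum_{n_1<\dots<n_k}x_{n_1}^{i_1}\cdots x_{n_k}^{i_k}$ for compositions $I=(i_1,\dots,i_k)$, $M_\emptyset=1$, and coproduct $\Delta(M_K)=\sum_{I\sqcup J=K}M_I\otimes M_J$ ($\sqcup$ = juxtaposition). $\mathrm{NSym}=k\langle E_1,E_2,\dots\rangle$ is the free associative algebra ($\deg E_i=i$) with $\Delta(E_n)=\sum_{i+j=n}E_i\otimes E_j$, $E_0=1$; $E_I=E_{i_1}\cdots E_{i_l}$; $\mathrm{NSym}$ and $\mathrm{QSym}$ are paired by $\langle E_I,M_J\rangle=\delta_{I,J}$. A rooted tree is a finite poset with a unique maximal element (root) such that for each vertex the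 set of vertices exceeding it is a chain; $|t|$ is its number of vertices and $\mathrm{Sym}(t)$ its automorphism group. For a forest (commutative monomial of rooted trees) $t_1\cdots t_k$, $B_+(t_1\cdots t_k)$ is the rooted tree obtained by adjoining a new root whose children are the roots of $t_1,\dots,t_k$; $B_+(1)=\bullet$ (one vertex); $B_-$ is the inverse bijection. $k\mathcal{T}$ is the vector space with basis the rooted trees, with Grossman–Larson product $\circ$: for $t=B_+(t_1\cdots t_n)$ and $t'$ with $m$ vertices, $t\circ t'$ is the sum of the $m^n$ trees obtained by attaching each $t_i$ to some vertex of $t'$ (root of $t_i$ becoming a child of that vertex), and $\bullet\circ t'=t'$. Inner product on $k\mathcal{T}$: $(t,t')=|\mathrm{Sym}(t)|\delta_{t,t'}$. $\mathcal{H}_K$ is the free commutative algebra on rooted trees (Connes–Kreimer Hopf algebra, with coproduct $\Delta(t)=t\otimes1+(\mathrm{id}\otimes B_+)\Delta(B_-(t))$ extended multiplicatively). $k\mathcal{T}$ and $\mathcal{H}_K$ are paired by $\langle t,u\rangle=(t,B_+(u))$ for rooted trees $t$ and forests $u$. Let $\kappa_n=\sum_{t:\,|t|=n+1}t/|\mathrm{Sym}(t)|$, $\epsilon_0=\bullet$, $\epsilon_n=\kappa_1\circ\epsilon_{n-1}-\kappa_2\circ\epsilon_{n-2}+\dots+(-1)^{n-1}\kappa_n$. $Z:\mathrm{NSym}\to k\mathcal{T}$ is the algebra homomorphism (for $\circ$) with $Z(E_n)=\epsilon_n$, and $Z^*:\mathcal{H}_K\to\mathrm{QSym}$ is the dual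 map defined by $\langle P,Z^*(u)\rangle=\langle Z(P),u\rangle$ for all $P\in\mathrm{NSym}$, $u\in\mathcal{H}_K$. *)

theory Defs
  imports Main "HOL-Library.Multiset" "HOL-Library.Poly_Mapping"
begin

text \<open>A rooted tree is a root together with the multiset of its subtrees.
  Thus  Node u  is  B_+(u)  for a forest (multiset of trees) u, and
  Node {#} is the one-vertex tree.\<close>
datatype tree = Node "tree multiset"

abbreviation bullet :: tree where "bullet \<equiv> Node {#}"

lemma tree_size_mem[termination_simp]:
  "z \<in># F \<Longrightarrow> size z < Suc (size_multiset size F)"
  by (induct F) (auto simp: size_multiset_add_mset)

fun tsize :: "tree \<Rightarrow> nat" where
  "tsize (Node F) = 1 + sum_mset (image_mset tsize F)"

text \<open>|Sym(t)|: number of automorphisms of the rooted tree, via the standard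
  recursion |Sym(B_+(s_1^{m_1}...s_r^{m_r}))| = prod_j m_j! |Sym(s_j)|^{m_j}
  (s_j pairwise distinct).\<close>
fun symc :: "tree \<Rightarrow> nat" where
  "symc (Node F) = (\<Prod>s\<in>set_mset F. fact (count F s) * symc s ^ count F s)"

text \<open>Auxiliary trees used to graft: vertices of kind N are the vertices of the
  original tree t' (eligible for grafting), a leaf X t is a grafted copy of t
  (its vertices are not eligible).\<close>
datatype xtree = X tree | N "xtree multiset"

lemma xtree_size_mem[termination_simp]:
  "z \<in># F \<Longrightarrow> size z < Suc (size_multiset size F)"
  by (induct F) (auto simp: size_multiset_add_mset)

fun to_x :: "tree \<Rightarrow> xtree" where
  "to_x (Node F) = N (image_mset to_x F)"

fun un_x :: "xtree \<Rightarrow> tree" where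
  "un_x (X t) = t"
| "un_x (N F) = Node (image_mset un_x F)"

fun attach :: "tree \<Rightarrow> xtree \<Rightarrow> xtree multiset" where
  "attach s (X t) = {#}"
| "attach s (N G) = {# N (add_mset (X s) G) #} +
     sum_mset (image_mset (\<lambda>c. image_mset (\<lambda>c'. N (add_mset c' (G - {#c#}))) (attach s c)) G)"

text \<open>Grossman--Larson product of two trees: for t = B_+(t_1...t_n) and t' with m
  vertices, the multiset of the m^n trees obtained by attaching each t_i to some
  vertex of t' (each t_i independently, to a vertex of the original t').\<close>
definition gl_tree :: "tree \<Rightarrow> tree \<Rightarrow> tree multiset" where
  "gl_tree t t' = (case t of Node F \<Rightarrow>
     image_mset un_x (fold_mset (\<lambda>s M. sum_mset (image_mset (attach s) M)) {#to_x t'#} F))"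

type_synonym 'k kT = "tree \<Rightarrow>\<^sub>0 'k"

definition mset_vec :: "'a multiset \<Rightarrow> 'a \<Rightarrow>\<^sub>0 'k::comm_ring_1" where
  "mset_vec M = sum_mset (image_mset (\<lambda>r. Poly_Mapping.single r 1) M)"

definition gl :: "'k::comm_ring_1 kT \<Rightarrow> 'k kT \<Rightarrow> 'k kT" (infixl \<open>\<circ>\<^sub>G\<^sub>L\<close> 70) where
  "a \<circ>\<^sub>G\<^sub>L b = (\<Sum>t\<in>Poly_Mapping.keys a. \<Sum>t'\<in>Poly_Mapping.keys b.
      Poly_Mapping.map (\<lambda>x. Poly_Mapping.lookup a t * Poly_Mapping.lookup b t' * x) (mset_vec (gl_tree t t')))"

definition kappa :: "nat \<Rightarrow> 'k::field_char_0 kT" where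
  "kappa n = Abs_poly_mapping (\<lambda>t. if tsize t = n + 1 then 1 / of_nat (symc t) else 0)"

primrec eps_list :: "nat \<Rightarrow> 'k::field_char_0 kT list" where
  "eps_list 0 = [Poly_Mapping.single bullet 1]"
| "eps_list (Suc n) = eps_list n @
     [\<Sum>i\<in>{1..Suc n}. Poly_Mapping.map (\<lambda>x. (-1) ^ (i - 1) * x)
                           (kappa i \<circ>\<^sub>G\<^sub>L (eps_list n ! (Suc n - i)))]"

text \<open>eps_list n = [eps_0, ..., eps_n].\<close>
definition eps :: "nat \<Rightarrow> 'k::field_char_0 kT" where
  "eps n = last (eps_list n)"

definition composition :: "nat list \<Rightarrow> bool" where
  "composition I \<longleftrightarrow> (\<forall>i\<in>set I. 0 < i)"

text \<open>Z is the algebra homomorphism NSym \<rightarrow> (kT, o) with Z(E_n) = eps_n; on the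
  basis E_I = E_{i_1}...E_{i_l} of the free algebra NSym this is
  Z(E_I) = eps_{i_1} o ... o eps_{i_l}, and Z(1) = bullet (the unit of o).\<close>
definition Z_basis :: "nat list \<Rightarrow> 'k::field_char_0 kT" where
  "Z_basis I = foldr (\<lambda>i x. eps i \<circ>\<^sub>G\<^sub>L x) I (Poly_Mapping.single bullet 1)"

text \<open>H_K = free commutative algebra on rooted trees = monoid algebra of forests
  (multisets of trees); the monomial u is Poly_Mapping.single u 1, and the
  ring structure is the one of poly_mapping (convolution).\<close>
type_synonym 'k HK = "tree multiset \<Rightarrow>\<^sub>0 'k"

text \<open>Pairing <t,u> = (t, B_+(u)) with (t,t') = |Sym t| delta_{t,t'}, extended bilinearly.\<close>
definition pairing :: "'k::comm_ring_1 kT \<Rightarrow> 'k HK \<Rightarrow> 'k" where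
  "pairing a v = (\<Sum>u\<in>Poly_Mapping.keys v. Poly_Mapping.lookup v u * Poly_Mapping.lookup a (Node u) * of_nat (symc (Node u)))"

text \<open>An element of QSym is written sum_I c_I M_I; we store the coefficient
  function I \<mapsto> c_I (supported on compositions). M_empty = 1.\<close>
type_synonym 'k QSym = "nat list \<Rightarrow>\<^sub>0 'k"

definition qsym_elem :: "'k::zero QSym \<Rightarrow> bool" where
  "qsym_elem a \<longleftrightarrow> (\<forall>I\<in>Poly_Mapping.keys a. composition I)"

definition M :: "nat list \<Rightarrow> 'k::comm_ring_1 QSym" where
  "M I = Poly_Mapping.single I 1"

fun qsh :: "nat list \<Rightarrow> nat list \<Rightarrow> nat list multiset" where
  "qsh [] J = {#J#}"
| "qsh I [] = {#I#}"
| "qsh (i # I) (j # J) = image_mset (Cons i) (qsh I (j # J))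
     + image_mset (Cons j) (qsh (i # I) J) + image_mset (Cons (i + j)) (qsh I J)"

definition qmult :: "'k::comm_ring_1 QSym \<Rightarrow> 'k QSym \<Rightarrow> 'k QSym" where
  "qmult a b = (\<Sum>I\<in>Poly_Mapping.keys a. \<Sum>J\<in>Poly_Mapping.keys b.
      Poly_Mapping.map (\<lambda>x. Poly_Mapping.lookup a I * Poly_Mapping.lookup b J * x) (mset_vec (qsh I J)))"

definition qone :: "'k::comm_ring_1 QSym" where
  "qone = M []"

definition alpha_plus :: "'k::comm_ring_1 QSym \<Rightarrow> 'k QSym" where
  "alpha_plus a = (\<Sum>I\<in>Poly_Mapping.keys a. Poly_Mapping.single (I @ [1]) (Poly_Mapping.lookup a I))"

text \<open>Z^*: the dual map, <E_I, Z^*(v)> = <Z(E_I), v>, i.e.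
  Z^*(v) = sum over compositions I of <Z(E_I), v> M_I.\<close>
definition Zstar :: "'k::field_char_0 HK \<Rightarrow> 'k QSym" where
  "Zstar v = Abs_poly_mapping (\<lambda>I. if composition I then pairing (Z_basis I) v else 0)"

definition alg_hom_HK_QSym :: "('k::field_char_0 HK \<Rightarrow> 'k QSym) \<Rightarrow> bool" where
  "alg_hom_HK_QSym f \<longleftrightarrow>
     (\<forall>x. qsym_elem (f x)) \<and>
     (\<forall>x y. f (x + y) = f x + f y) \<and>
     (\<forall>c x. f (Poly_Mapping.map (\<lambda>z. c * z) x) = Poly_Mapping.map (\<lambda>z. c * z) (f x)) \<and>
     (\<forall>x y. f (x * y) = qmult (f x) (f y)) \<and>
     f 1 = qone"

end

theory Submission
  imports Defs
begin

text \<open>Grafting a forest onto a tree is adjoint to cutting, which turns the product of two trees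
  into the sum over the admissible cuts of a forest. By the alternating sum over cuts, the
  functional dual to eps n is 1 on the forest of n single vertices and 0 on all others. Hence
  the coefficient of M_I in Zstar u counts the ways to strip off u successively I_1, I_2, ...
  leaves; the last ones stripped are roots. For a tree B_+(u) the root goes alone in the last step,
  which is the recursion for alpha_plus. Stripping a disjoint union amounts to
  stripping both parts simultaneously, which gives the quasi-shuffle product. Uniqueness follows
  by induction, since B_+ and products generate all forests.\<close>

section \<open>Sums over multisets\<close>

lemma image_mset_eqI: "A = B \<Longrightarrow> (\<And>x. x \<in># B \<Longrightarrow> f x = g x) \<Longrightarrow> image_mset f A = image_mset g B"
  by (auto intro: image_mset_cong)

lemma sum_mset_cong: "(\<And>x. x \<in># A \<Longrightarrow> f x = g x) \<Longrightarrow> (\<Sum>x\<in>#A. f x) = (\<Sum>x\<in>#A. g x)"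
  for f :: "'b \<Rightarrow> 'c::comm_monoid_add"
  by (simp cong: image_mset_eqI)

lemma sum_mset_UN: "(\<Sum>x\<in>#(\<Sum>a\<in>#A. g a). f x) = (\<Sum>a\<in>#A. \<Sum>x\<in>#g a. f x)"
  for f :: "'b \<Rightarrow> 'c::comm_monoid_add"
  by (induction A) auto

text \<open>Both sums run over the ordered pairs of distinct occurrences in \<open>G\<close>, a set
  of pairs closed under swapping. This serves two grafts that land in different children.\<close>

lemma sum_mset_ordered_pairs_swap:
  fixes h :: "'a \<Rightarrow> 'a \<Rightarrow> 'b::comm_monoid_add"
  shows "(\<Sum>g\<in>#G. \<Sum>g'\<in>#G - {#g#}. h g g') = (\<Sum>g\<in>#G. \<Sum>g'\<in>#G - {#g#}. h g' g)"
proof (induction G)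
  case (add a G)
  have "(\<Sum>g\<in>#G. \<Sum>g'\<in>#add_mset a G - {#g#}. h g g')
      = (\<Sum>g\<in>#G. h g a + (\<Sum>g'\<in>#G - {#g#}. h g g'))" for h :: "'a \<Rightarrow> 'a \<Rightarrow> 'b"
    by (rule arg_cong[of _ _ sum_mset], rule image_mset_cong) simp
  then show ?case
    using add by (simp add: sum_mset.distrib ac_simps)
qed simp

section \<open>Symmetry weights and inner products of forests\<close>

text \<open>For \<open>w = symc\<close> this is the number of automorphisms of
  \<open>Node F\<close>. Keeping \<open>w\<close> generic lets one theory serve both
  \<open>tree\<close> and \<open>xtree\<close>.\<close>

definition forest_weight :: "('a \<Rightarrow> nat) \<Rightarrow> 'a multiset \<Rightarrow> nat" where
  "forest_weight w F = (\<Prod>s\<in>set_mset F. fact (count F s) * w s ^ count F s)"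

text \<open>Only the factor of \<open>s\<close> changes, which turns the product over distinct
  components into a recursion on multisets.\<close>

lemma forest_weight_add:
  "forest_weight w (add_mset s F) = Suc (count F s) * w s * forest_weight w F"
proof -
  let ?g = "\<lambda>F s. fact (count F s) * w s ^ count F s"
  have e: "forest_weight w F = (\<Prod>x\<in>insert s (set_mset F). ?g F x)" for F
    unfolding forest_weight_def
    by (rule prod.mono_neutral_left) (auto simp: not_in_iff)
  have "forest_weight w (add_mset s F) = ?g (add_mset s F) s * (\<Prod>x\<in>set_mset F - {s}. ?g (add_mset s F) x)"
    using e[of "add_mset s F"] by (simp add: prod.insert_remove)
  also have "(\<Prod>x\<in>set_mset F - {s}. ?g (add_mset s F) x) = (\<Prod>x\<in>set_mset F - {s}. ?g F x)"
    by (rule prod.cong) auto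
  also have "?g (add_mset s F) s = Suc (count F s) * w s * ?g F s"
    by (simp add: algebra_simps)
  finally show ?thesis
    using e[of F] by (simp add: prod.insert_remove mult.assoc)
qed

text \<open>An injective \<open>g\<close> keeps all multiplicities.\<close>

lemma forest_weight_image:
  assumes "inj_on g (set_mset F)" "\<And>s. s \<in># F \<Longrightarrow> w' (g s) = w s"
  shows "forest_weight w' (image_mset g F) = forest_weight w F"
  using assms
proof (induction F)
  case (add s F)
  have "count (image_mset g F) (g s) = count F s"
  proof (cases "s \<in># F")
    case True
    then have "g -` {g s} \<inter> set_mset F = {s}" using add.prems(1)
      by (auto simp: inj_on_def)
    then show ?thesis by (simp add: count_image_mset)
  next
    case False
    then have "g s \<notin># image_mset g F"
      using add.prems(1) by (auto simp: inj_on_def)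
    with False show ?thesis by (metis not_in_iff)
  qed
  then show ?case using add by (simp add: forest_weight_add inj_on_def)
qed (simp add: forest_weight_def)

definition delta :: "('a \<Rightarrow> nat) \<Rightarrow> 'a \<Rightarrow> 'a \<Rightarrow> nat" where
  "delta w x y = (if x = y then w x else 0)"

lemma delta_sym: "delta w x y = delta w y x"
  by (auto simp: delta_def)

lemma sum_mset_delta_eq:
  "(\<Sum>g\<in>#G. (if s = g then f g else 0)) = of_nat (count G s) * (f s :: 'a::semiring_1)"
  by (induction G) (auto simp: algebra_simps)

text \<open>Multiplication by s is adjoint to a derivation, for the inner product
  that makes distinct forests orthogonal.\<close>
lemma delta_forest_add:
  "delta (forest_weight w) (add_mset s F) G
     = (\<Sum>g\<in>#G. delta w s g * delta (forest_weight w) F (G - {#g#}))"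
proof -
  have "(\<Sum>g\<in>#G. delta w s g * delta (forest_weight w) F (G - {#g#}))
      = (\<Sum>g\<in>#G. (if s = g then w g * delta (forest_weight w) F (G - {#g#}) else 0))"
    by (rule arg_cong[of _ _ sum_mset], rule image_mset_cong) (simp add: delta_def)
  \<comment> \<open>All occurrences of \<open>s\<close> in \<open>G\<close> give the same term;
    their number is the factor produced by \<open>forest_weight_add\<close>.\<close>
  also have "\<dots> = count G s * (w s * delta (forest_weight w) F (G - {#s#}))"
    by (subst sum_mset_delta_eq) simp
  also have "\<dots> = delta (forest_weight w) (add_mset s F) G"
    by (cases "s \<in># G") (auto simp: delta_def forest_weight_add not_in_iff algebra_simps dest!: multi_member_split)
  finally show ?thesis ..
qed

lemma delta_forest_add_right:
  "delta (forest_weight w) F (add_mset s G)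
     = (\<Sum>g\<in>#F. delta w g s * delta (forest_weight w) (F - {#g#}) G)"
  using delta_forest_add[of w s G F] by (simp add: delta_sym[of _ F] delta_sym[of _ _ G] delta_sym[of _ _ s])

section \<open>Marked trees and the adjoint of a single graft\<close>

text \<open>Counts the automorphisms that respect the marking: a grafted copy \<open>X t\<close>
  contributes those of \<open>t\<close> and is never identified with original vertices.\<close>

fun xsymc :: "xtree \<Rightarrow> nat" where
  "xsymc (X t) = symc t"
| "xsymc (N F) = (\<Prod>s\<in>set_mset F. fact (count F s) * xsymc s ^ count F s)"

lemma symc_eq: "symc (Node F) = forest_weight symc F"
  by (simp add: forest_weight_def)

lemma xsymc_eq: "xsymc (N F) = forest_weight xsymc F"
  by (simp add: forest_weight_def)

declare symc.simps [simp del] xsymc.simps(2) [simp del]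

abbreviation ip where "ip \<equiv> delta symc"
abbreviation ipF where "ipF \<equiv> delta (forest_weight symc)"
abbreviation xip where "xip \<equiv> delta xsymc"
abbreviation xipF where "xipF \<equiv> delta (forest_weight xsymc)"

lemma delta_simps [simp]:
  "ip (Node F) (Node G) = ipF F G"
  "xip (N A) (N B) = xipF A B"
  "xip (X s) (X t) = ip s t"
  "xip (X s) (N B) = 0"
  "xip (N A) (X t) = 0"
  by (simp_all add: delta_def symc_eq xsymc_eq)

text \<open>The adjoint of attach s, in functional form: the sum of \<phi> over all ways of removing
  one grafted leaf X t, weighted by the inner product of s and t.\<close>
fun prune :: "tree \<Rightarrow> (xtree \<Rightarrow> nat) \<Rightarrow> xtree \<Rightarrow> nat" where
  "prune s \<phi> (X t) = 0"
| "prune s \<phi> (N G) = (\<Sum>g\<in>#G. xip (X s) g * \<phi> (N (G - {#g#}))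
      + prune s (\<lambda>g'. \<phi> (N (add_mset g' (G - {#g#})))) g)"

lemma prune_sum: "prune s (\<lambda>y. \<Sum>c\<in>#C. f c y) y = (\<Sum>c\<in>#C. prune s (f c) y)"
proof (induction y arbitrary: f)
  case (N G)
  then show ?case
    by (simp add: sum_mset_distrib_left sum_mset.distrib sum_mset.swap[of _ G] cong: image_mset_eqI)
qed simp

lemma prune_mult: "prune s (\<lambda>y. f y * k) y = prune s f y * k"
proof (induction y arbitrary: f)
  case (N G)
  then show ?case
    by (simp add: sum_mset_distrib_right distrib_right mult.assoc cong: image_mset_eqI)
qed simp

lemma prune_zero [simp]: "prune s (\<lambda>y. 0) y = 0"
  using prune_mult[of s "\<lambda>y. 0" 0 y] by simp

text \<open>The derivation rule is applied on both sides. A graft at the root matches the removal of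
  a leaf child; a graft inside a child \<open>c\<close> matches pairing \<open>c\<close> with some
  child \<open>h\<close> of \<open>y\<close> and pruning inside \<open>h\<close>.\<close>

lemma attach_prune_adjoint: "(\<Sum>z\<in>#attach s x. xip z y) = prune s (xip x) y"
proof (induction x arbitrary: y)
  case (X t)
  show ?case
  proof (cases y)
    case (N H)
    have "prune s (xip (X t)) (N H) = 0" by (simp add: image_mset_const_eq)
    with N show ?thesis by simp
  qed simp
next
  case (N G)
  show ?case
  proof (cases y)
    case (X t)
    then show ?thesis by (simp add: sum_mset_UN)
  next
    case y: (N H)
    have "(\<Sum>c\<in>#G. \<Sum>c'\<in>#attach s c. xipF (add_mset c' (G - {#c#})) H)
        = (\<Sum>c\<in>#G. \<Sum>h\<in>#H. prune s (xip c) h * xipF (G - {#c#}) (H - {#h#}))"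
      using N by (simp add: delta_forest_add sum_mset.swap[of _ H] sum_mset_distrib_right[symmetric] cong: image_mset_eqI)
    also have "\<dots> = (\<Sum>h\<in>#H. prune s (\<lambda>g'. xipF G (add_mset g' (H - {#h#}))) h)"
      by (simp add: delta_forest_add_right prune_sum prune_mult sum_mset.swap[of _ G H])
    finally show ?thesis using y
      by (simp add: sum_mset_UN image_mset.compositionality comp_def delta_forest_add sum_mset.distrib)
  qed
qed

section \<open>Independence of the order of grafting\<close>

lemma attach_N_sum:
  "(\<Sum>z\<in>#attach s (N G). \<phi> z) = \<phi> (N (add_mset (X s) G)) +
     (\<Sum>c\<in>#G. \<Sum>c'\<in>#attach s c. \<phi> (N (add_mset c' (G - {#c#}))))"
  by (simp add: sum_mset_UN image_mset.compositionality comp_def)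

text \<open>Grafted copies are not eligible for further grafts, so both trees choose among the same
  vertices in either order.\<close>

lemma attach_comm:
  fixes \<phi> :: "xtree \<Rightarrow> 'b::comm_monoid_add"
  shows "(\<Sum>z\<in>#attach s x. \<Sum>w\<in>#attach s' z. \<phi> w) = (\<Sum>z\<in>#attach s' x. \<Sum>w\<in>#attach s z. \<phi> w)"
proof (induction x arbitrary: \<phi>)
  case (N G)
  \<comment> \<open>Positions of the two grafts apart from both at the root: one at the root, both
    in the same child, or in two different children.\<close>
  let ?one = "\<lambda>s s'. \<Sum>c\<in>#G. \<Sum>c'\<in>#attach s' c. \<phi> (N (add_mset (X s) (add_mset c' (G - {#c#}))))"
  let ?two = "\<lambda>s s'. \<Sum>c\<in>#G. \<Sum>c'\<in>#attach s c. \<Sum>c''\<in>#attach s' c'. \<phi> (N (add_mset c'' (G - {#c#})))"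
  let ?three = "\<lambda>s s'. \<Sum>c\<in>#G. \<Sum>d\<in>#G - {#c#}. \<Sum>c'\<in>#attach s c. \<Sum>d'\<in>#attach s' d.
     \<phi> (N (add_mset c' (add_mset d' (G - {#c#} - {#d#}))))"
  have expand: "(\<Sum>z\<in>#attach s (N G). \<Sum>w\<in>#attach s' z. \<phi> w)
      = \<phi> (N (add_mset (X s) (add_mset (X s') G))) + ?one s s' + ?one s' s + ?two s s' + ?three s s'" for s s'
  proof -
    have a: "(\<Sum>w\<in>#attach s' (N (add_mset (X s) G)). \<phi> w) = \<phi> (N (add_mset (X s) (add_mset (X s') G))) + ?one s s'"
      unfolding attach_N_sum
      by (simp add: add_mset_commute cong: image_mset_eqI)
    have b: "(\<Sum>w\<in>#attach s' (N (add_mset c' (G - {#c#}))). \<phi> w) =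
       \<phi> (N (add_mset (X s') (add_mset c' (G - {#c#}))))
       + (\<Sum>c''\<in>#attach s' c'. \<phi> (N (add_mset c'' (G - {#c#}))))
       + (\<Sum>d\<in>#G - {#c#}. \<Sum>d'\<in>#attach s' d. \<phi> (N (add_mset c' (add_mset d' (G - {#c#} - {#d#})))))" for c c'
      unfolding attach_N_sum
      by (simp add: add_mset_commute[of c'] ac_simps cong: image_mset_eqI)
    show ?thesis
      unfolding attach_N_sum[of _ s] a b
      by (simp add: sum_mset.distrib ac_simps sum_mset.swap[of _ "attach s _"])
  qed
  have two: "?two s s' = ?two s' s"
    by (intro arg_cong[of _ _ sum_mset] image_mset_cong N)
  have three: "?three s s' = ?three s' s"
    by (subst sum_mset_ordered_pairs_swap)
      (simp add: add_mset_commute diff_right_commute sum_mset.swap[of _ "attach s _" "attach s' _"])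
  show ?case
    unfolding expand two three by (simp add: ac_simps add_mset_commute)
qed simp

definition graft_step :: "tree \<Rightarrow> xtree multiset \<Rightarrow> xtree multiset" where
  "graft_step s A = (\<Sum>x\<in>#A. attach s x)"

lemma graft_step_comm: "graft_step s (graft_step s' A) = graft_step s' (graft_step s A)"
proof -
  have "(\<Sum>x\<in>#attach s' a. attach s x) = (\<Sum>x\<in>#attach s a. attach s' x)" for a
    using attach_comm[of "\<lambda>w. {#w#}" s s' a] by simp
  then show ?thesis by (simp add: graft_step_def sum_mset_UN)
qed

text \<open>This is what makes the \<open>fold_mset\<close> in \<open>gl_tree\<close> unfold one
  tree at a time.\<close>

interpretation graft_step: comp_fun_commute graft_step
  by unfold_locales (auto simp: graft_step_comm)

definition grafts :: "tree multiset \<Rightarrow> tree \<Rightarrow> xtree multiset" where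
  "grafts F t = fold_mset graft_step {#to_x t#} F"

lemma grafts_simps [simp]:
  "grafts {#} t = {#to_x t#}"
  "grafts (add_mset s F) t = (\<Sum>x\<in>#grafts F t. attach s x)"
  by (simp_all add: grafts_def graft_step_def)

lemma gl_tree_grafts: "gl_tree (Node F) t = image_mset un_x (grafts F t)"
  by (simp add: gl_tree_def grafts_def graft_step_def[abs_def])

section \<open>Grafting a forest: grafted part and remaining tree\<close>

fun crown :: "xtree \<Rightarrow> tree multiset" where
  "crown (X t) = {#t#}"
| "crown (N G) = (\<Sum>g\<in>#G. crown g)"

text \<open>The tree of ungrafted vertices, as a forest with at most one component.\<close>
fun trunk :: "xtree \<Rightarrow> tree multiset" where
  "trunk (X t) = {#}"
| "trunk (N G) = {#Node (\<Sum>g\<in>#G. trunk g)#}"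

lemma sum_mset_remove:
  fixes f :: "'a \<Rightarrow> 'b multiset"
  shows "g \<in># G \<Longrightarrow> (\<Sum>x\<in>#G. f x) = f g + (\<Sum>x\<in>#G - {#g#}. f x)"
  by (auto dest!: multi_member_split)

text \<open>Pruning takes one entry out of the crown and leaves the trunk alone. The
  \<open>case\<close> term accounts for \<open>y = X t\<close>, a leaf without a parent, which
  \<open>prune\<close> cannot remove; with it the identity passes to children.\<close>

lemma prune_crown_trunk:
  "prune s (\<lambda>y'. \<psi> (crown y') (trunk y')) y + (case y of X t \<Rightarrow> ip s t * \<psi> {#} {#} | N _ \<Rightarrow> 0)
     = (\<Sum>c\<in>#crown y. ip s c * \<psi> (crown y - {#c#}) (trunk y))"
proof (induction y arbitrary: \<psi>)
  case (N G)
  have "xip (X s) g * \<psi> (crown (N (G - {#g#}))) (trunk (N (G - {#g#})))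
      + prune s (\<lambda>g'. \<psi> (crown (N (add_mset g' (G - {#g#})))) (trunk (N (add_mset g' (G - {#g#}))))) g
      = (\<Sum>c\<in>#crown g. ip s c * \<psi> (crown (N G) - {#c#}) (trunk (N G)))" (is "?l = ?r") if g: "g \<in># G" for g
  proof -
    let ?C = "\<Sum>x\<in>#G - {#g#}. crown x" and ?T = "\<Sum>x\<in>#G - {#g#}. trunk x"
    have G: "(\<Sum>x\<in>#G. crown x) = crown g + ?C" "(\<Sum>x\<in>#G. trunk x) = trunk g + ?T"
      using g by (rule sum_mset_remove)+
    have "?l = prune s (\<lambda>y'. (\<lambda>c t. \<psi> (c + ?C) {#Node (t + ?T)#}) (crown y') (trunk y')) g
       + (case g of X t \<Rightarrow> ip s t * (\<lambda>c t. \<psi> (c + ?C) {#Node (t + ?T)#}) {#} {#} | N _ \<Rightarrow> 0)"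
      by (cases g) auto
    also have "\<dots> = (\<Sum>c\<in>#crown g. ip s c * \<psi> (crown g - {#c#} + ?C) {#Node (trunk g + ?T)#})"
      by (rule N.IH[OF g])
    also have "\<dots> = ?r"
      using G by (auto intro!: arg_cong[of _ _ sum_mset] image_mset_cong)
    finally show ?thesis .
  qed
  then show ?case
    by (simp add: sum_mset_UN cong: image_mset_eqI)
qed simp

lemma inj_to_x: "to_x t = to_x t' \<Longrightarrow> t = t'"
proof (induction t arbitrary: t')
  case (Node F)
  obtain G where t': "t' = Node G" by (cases t')
  have "image_mset to_x F = image_mset to_x G" using Node.prems t' by simp
  moreover have "\<forall>G. image_mset to_x F = image_mset to_x G \<longrightarrow> F = G" if "\<And>x y. x \<in># F \<Longrightarrow> to_x x = to_x y \<Longrightarrow> x = y" for F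
    using that
  proof (induction F)
    case (add x F)
    show ?case
    proof (intro allI impI)
      fix G assume e: "image_mset to_x (add_mset x F) = image_mset to_x G"
      then obtain y where y: "y \<in># G" "to_x x = to_x y" by (metis image_iff image_mset_add_mset set_image_mset union_single_eq_member)
      then have "x \<in># G" using add.prems[of x y] by simp
      then obtain G' where "G = add_mset x G'" by (metis multi_member_split)
      with e add show "add_mset x F = G" by auto
    qed
  qed simp
  ultimately show ?case using Node.IH t' by blast
qed

lemma xsymc_to_x [simp]: "xsymc (to_x t) = symc t"
proof (induction t)
  case (Node F)
  have "forest_weight xsymc (image_mset to_x F) = forest_weight symc F"
    using Node by (intro forest_weight_image) (auto simp: inj_on_def dest: inj_to_x)
  then show ?case by (simp add: xsymc_eq symc_eq)
qed

lemma crown_to_x [simp]: "crown (to_x t) = {#}"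
  by (induction t) auto

lemma trunk_to_x [simp]: "trunk (to_x t) = {#t#}"
proof (induction t)
  case (Node F)
  then have "(\<Sum>g\<in>#F. trunk (to_x g)) = (\<Sum>g\<in>#F. {#g#})"
    by (intro arg_cong[of _ _ sum_mset] image_mset_cong)
  then show ?case by (simp add: image_mset.compositionality comp_def)
qed

lemma crown_empty: "crown y = {#} \<Longrightarrow> \<exists>t. y = to_x t"
proof (induction y)
  case (N G)
  then have "\<forall>g\<in>#G. \<exists>t. g = to_x t" by auto
  then obtain f where "\<forall>g\<in>#G. g = to_x (f g)" by metis
  then have "G = image_mset to_x (image_mset f G)"
    by (simp add: image_mset.compositionality comp_def cong: image_mset_eqI)
  then show ?case by (metis to_x.simps)
qed simp

lemma forest_weight_single [simp]: "forest_weight w {#s#} = w s"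
  by (simp add: forest_weight_def)

lemma delta_forest_empty [simp]: "delta (forest_weight w) {#} {#} = 1"
  by (simp add: delta_def forest_weight_def)

text \<open>A marked tree with empty crown has only original vertices, so it is determined by its
  trunk.\<close>

lemma xip_to_x: "xip (to_x t) y = ipF {#} (crown y) * ipF {#t#} (trunk y)"
proof (cases "crown y = {#}")
  case True
  then obtain t' where "y = to_x t'" using crown_empty by blast
  then show ?thesis by (auto simp: delta_def forest_weight_def dest: inj_to_x)
next
  case False
  then have "y \<noteq> to_x t" by auto
  with False show ?thesis by (simp add: delta_def)
qed

text \<open>Pruning the trees of \<open>F\<close> one after another consumes the crown by the
  derivation rule; once it is empty, the trunk is compared with \<open>t\<close>.\<close>

lemma grafts_adjoint: "(\<Sum>z\<in>#grafts F t. xip z y) = ipF F (crown y) * ipF {#t#} (trunk y)"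
proof (induction F arbitrary: y)
  case empty
  then show ?case by (simp add: xip_to_x)
next
  case (add s F)
  have "(\<Sum>z\<in>#grafts (add_mset s F) t. xip z y) = prune s (\<lambda>y'. \<Sum>w\<in>#grafts F t. xip w y') y"
    by (simp add: sum_mset_UN attach_prune_adjoint prune_sum)
  also have "\<dots> = prune s (\<lambda>y'. ipF F (crown y') * ipF {#t#} (trunk y')) y"
    by (simp add: add)
  also have "\<dots> = ipF (add_mset s F) (crown y) * ipF {#t#} (trunk y)"
  proof (cases y)
    case (X t)
    then show ?thesis by (simp add: delta_def)
  next
    case (N G)
    then show ?thesis
      using prune_crown_trunk[of s "\<lambda>c tr. ipF F c * ipF {#t#} tr" y]
      by (simp add: delta_forest_add sum_mset_distrib_right mult.assoc)
  qed
  finally show ?case .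
qed

section \<open>Admissible cuts and the coproduct of forests\<close>

definition choose_add :: "'a multiset \<Rightarrow> 'a multiset multiset \<Rightarrow> 'a multiset multiset" where
  "choose_add A S = (\<Sum>a\<in>#A. image_mset (add_mset a) S)"

lemma choose_add_sum: "(\<Sum>Y\<in>#choose_add A S. f Y) = (\<Sum>a\<in>#A. \<Sum>Y\<in>#S. f (add_mset a Y))"
  for f :: "'a multiset \<Rightarrow> 'b::comm_monoid_add"
  by (simp add: choose_add_def sum_mset_UN image_mset.compositionality comp_def)

lemma choose_add_comm: "choose_add A (choose_add B S) = choose_add B (choose_add A S)"
proof -
  have single: "(\<Sum>Y\<in>#T. {#Y#}) = T" for T :: "'a multiset multiset"
    by (induction T) auto
  have "(\<Sum>a\<in>#A. \<Sum>b\<in>#B. \<Sum>Y\<in>#S. {#add_mset b (add_mset a Y)#})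
      = (\<Sum>b\<in>#B. \<Sum>a\<in>#A. \<Sum>Y\<in>#S. {#add_mset a (add_mset b Y)#})"
    by (subst sum_mset.swap) (simp only: add_mset_commute)
  then have "(\<Sum>Y\<in>#choose_add A (choose_add B S). {#Y#}) = (\<Sum>Y\<in>#choose_add B (choose_add A S). {#Y#})"
    by (simp only: choose_add_sum add_mset_commute)
  then show ?thesis by (simp only: single)
qed

interpretation choose_add: comp_fun_commute choose_add
  by unfold_locales (auto simp: choose_add_comm)

text \<open>An unordered Cartesian product with multiplicities: one element out of each
  member.\<close>

definition choices :: "'a multiset multiset \<Rightarrow> 'a multiset multiset" where
  "choices = fold_mset choose_add {#{#}#}"

lemma choices_empty [simp]: "choices {#} = {#{#}#}"
  by (simp add: choices_def)

lemma choices_add: "(\<Sum>Y\<in>#choices (add_mset A S). f Y) = (\<Sum>a\<in>#A. \<Sum>Y\<in>#choices S. f (add_mset a Y))"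
  for f :: "'a multiset \<Rightarrow> 'b::comm_monoid_add"
  by (simp add: choices_def choose_add_sum)

text \<open>All xtrees with underlying tree t; these correspond to the admissible cuts,
  including the total one.\<close>
fun cuts :: "tree \<Rightarrow> xtree multiset" where
  "cuts (Node F) = add_mset (X (Node F)) (image_mset N (choices (image_mset cuts F)))"

text \<open>The derivation rule takes one tree \<open>h\<close> off \<open>H\<close> and matches it
  with some entry of \<open>F\<close>; the choices in \<open>h\<close> and in the rest are
  independent. The assumption is limited to entries of \<open>F\<close> so that an induction
  hypothesis can discharge it.\<close>

lemma un_x_forest_adjoint:
  assumes "\<And>x h. x \<in># F \<Longrightarrow> ip (un_x x) h = (\<Sum>y\<in>#cuts h. xip x y)"
  shows "ipF (image_mset un_x F) H = (\<Sum>Y\<in>#choices (image_mset cuts H). xipF F Y)"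
  using assms
proof (induction H arbitrary: F)
  case empty
  show ?case by (auto simp: delta_def forest_weight_def)
next
  case (add h H)
  have "ipF (image_mset un_x F) (add_mset h H)
      = (\<Sum>s\<in>#F. ip (un_x s) h * ipF (image_mset un_x F - {#un_x s#}) H)"
    by (simp add: delta_forest_add_right image_mset.compositionality comp_def)
  also have "\<dots> = (\<Sum>s\<in>#F. \<Sum>y\<in>#cuts h. \<Sum>Y\<in>#choices (image_mset cuts H). xip s y * xipF (F - {#s#}) Y)"
  proof (intro arg_cong[of _ _ sum_mset] image_mset_cong)
    fix s assume s: "s \<in># F"
    then have "image_mset un_x F - {#un_x s#} = image_mset un_x (F - {#s#})"
      by (auto dest!: multi_member_split)
    moreover have "ipF (image_mset un_x (F - {#s#})) H = (\<Sum>Y\<in>#choices (image_mset cuts H). xipF (F - {#s#}) Y)"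
      by (rule add.IH) (auto dest: in_diffD add.prems)
    ultimately show "ip (un_x s) h * ipF (image_mset un_x F - {#un_x s#}) H
       = (\<Sum>y\<in>#cuts h. \<Sum>Y\<in>#choices (image_mset cuts H). xip s y * xipF (F - {#s#}) Y)"
      using add.prems[OF s] by (simp add: sum_mset_distrib_left sum_mset_distrib_right sum_mset.swap[of _ "cuts h"])
  qed
  also have "\<dots> = (\<Sum>Y\<in>#choices (image_mset cuts (add_mset h H)). xipF F Y)"
    by (simp add: choices_add delta_forest_add_right sum_mset.swap[of _ F])
  finally show ?case .
qed

text \<open>Forgetting the marks is adjoint to summing over all markings. In terms of weights this
  is an orbit-stabilizer count: \<open>xsymc x\<close> is the stabilizer of a marking under the
  automorphisms of \<open>t\<close>.\<close>

lemma un_x_adjoint: "ip (un_x x) t = (\<Sum>y\<in>#cuts t. xip x y)"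
proof (induction x arbitrary: t)
  case (X s)
  show ?case by (cases t) (simp add: image_mset.compositionality comp_def)
next
  case (N G)
  show ?case
    by (cases t) (simp add: image_mset.compositionality comp_def un_x_forest_adjoint[OF N])
qed

text \<open>The Connes--Kreimer coproduct of a forest, as a multiset of pairs
  (pruned part, trunk).\<close>
definition cop :: "tree multiset \<Rightarrow> (tree multiset \<times> tree multiset) multiset" where
  "cop H = image_mset (\<lambda>Y. (\<Sum>y\<in>#Y. crown y, \<Sum>y\<in>#Y. trunk y)) (choices (image_mset cuts H))"

lemma gl_tree_adjoint:
  "(\<Sum>r\<in>#gl_tree t t'. ip r (Node H)) = (\<Sum>(P, R)\<in>#cop H. ip t (Node P) * ip t' (Node R))"
proof -
  obtain F where t: "t = Node F" by (cases t)
  have single: "ipF {#t'#} {#s#} = ip t' s" for s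
    by (simp add: delta_def)
  have "(\<Sum>r\<in>#gl_tree t t'. ip r (Node H)) = (\<Sum>y\<in>#cuts (Node H). \<Sum>z\<in>#grafts F t'. xip z y)"
    by (simp add: t gl_tree_grafts image_mset.compositionality comp_def un_x_adjoint sum_mset.swap[of _ "grafts F t'"] del: cuts.simps)
  \<comment> \<open>The total cut \<open>X (Node H)\<close> has empty trunk, so it pairs to zero
    with \<open>{#t'#}\<close>; the other cuts are those recorded in \<open>cop H\<close>.\<close>
  also have "\<dots> = (\<Sum>(P, R)\<in>#cop H. ip t (Node P) * ip t' (Node R))"
    by (simp add: grafts_adjoint cop_def image_mset.compositionality comp_def t single)
      (simp add: delta_def)
  finally show ?thesis .
qed

lemma cop_empty [simp]: "cop {#} = {#({#}, {#})#}"
  by (simp add: cop_def)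

text \<open>The component \<open>Node K\<close> is either cut off as a whole, or it keeps its root
  and is cut inside \<open>K\<close>.\<close>

lemma cop_add:
  fixes f :: "tree multiset \<times> tree multiset \<Rightarrow> 'b::comm_monoid_add"
  shows "(\<Sum>p\<in>#cop (add_mset (Node K) H). f p) =
    (\<Sum>(P, R)\<in>#cop H. f (add_mset (Node K) P, R))
    + (\<Sum>(P', R')\<in>#cop K. \<Sum>(P, R)\<in>#cop H. f (P' + P, add_mset (Node R') R))"
  by (simp add: cop_def image_mset.compositionality comp_def choices_add)

section \<open>The product on trees as dual of the coproduct\<close>

definition pr :: "'k::comm_ring_1 kT \<Rightarrow> tree multiset \<Rightarrow> 'k" where
  "pr a u = Poly_Mapping.lookup a (Node u) * of_nat (symc (Node u))"

lemma pairing_pr: "pairing a v = (\<Sum>u\<in>Poly_Mapping.keys v. Poly_Mapping.lookup v u * pr a u)"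
  by (simp add: pairing_def pr_def mult.assoc)

lemma lookup_scale [simp]:
  "Poly_Mapping.lookup (Poly_Mapping.map (\<lambda>x. c * x) p) k = c * Poly_Mapping.lookup p k"
  for c :: "'k::comm_ring_1"
  by (simp add: Poly_Mapping.map.rep_eq when_def)

lemma lookup_mset_vec [simp]: "Poly_Mapping.lookup (mset_vec A) r = of_nat (count A r)"
proof -
  have "Poly_Mapping.lookup (\<Sum>r\<in>#A. Poly_Mapping.single r 1) r = of_nat (count A r)"
    by (induction A) (auto simp: lookup_add lookup_single when_def)
  then show ?thesis by (simp add: mset_vec_def)
qed

text \<open>Makes the pairing bilinear in \<open>ip\<close>, so that the adjunction for trees
  extends to linear combinations.\<close>

lemma pr_delta: "pr a P = (\<Sum>t\<in>Poly_Mapping.keys a. Poly_Mapping.lookup a t * of_nat (ip t (Node P)))"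
proof -
  have "(\<Sum>t\<in>Poly_Mapping.keys a. Poly_Mapping.lookup a t * of_nat (ip t (Node P)))
      = (\<Sum>t\<in>Poly_Mapping.keys a. if t = Node P then pr a P else 0)"
    by (rule sum.cong) (auto simp: pr_def delta_def)
  then show ?thesis by (auto simp: pr_def in_keys_iff)
qed

lemma of_nat_sum_mset: "of_nat (\<Sum>x\<in>#A. f x) = (\<Sum>x\<in>#A. of_nat (f x) :: 'k::semiring_1)"
  by (induction A) auto

lemma sum_sum_mset: "(\<Sum>x\<in>S. \<Sum>y\<in>#A. f x y) = (\<Sum>y\<in>#A. \<Sum>x\<in>S. f x y)"
  for f :: "'a \<Rightarrow> 'b \<Rightarrow> 'c::comm_monoid_add"
  by (induction A) (auto simp: sum.distrib)

lemma sum_mset_ip: "(\<Sum>r\<in>#A. ip r t) = count A t * symc t"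
  using sum_mset_delta_eq[of t symc A] by (simp add: delta_sym[of _ _ t]) (simp add: delta_def cong: if_cong)

lemma pr_gl: "pr (a \<circ>\<^sub>G\<^sub>L b) H = (\<Sum>(P, R)\<in>#cop H. pr a P * pr b R)"
proof -
  have "pr (a \<circ>\<^sub>G\<^sub>L b) H = (\<Sum>t\<in>Poly_Mapping.keys a. \<Sum>t'\<in>Poly_Mapping.keys b.
      Poly_Mapping.lookup a t * Poly_Mapping.lookup b t' * of_nat (\<Sum>r\<in>#gl_tree t t'. ip r (Node H)))"
    by (simp add: pr_def gl_def lookup_sum sum_distrib_right sum_mset_ip) (simp add: mult.assoc)
  also have "\<dots> = (\<Sum>t\<in>Poly_Mapping.keys a. \<Sum>t'\<in>Poly_Mapping.keys b. \<Sum>p\<in>#cop H.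
      (Poly_Mapping.lookup a t * of_nat (ip t (Node (fst p)))) * (Poly_Mapping.lookup b t' * of_nat (ip t' (Node (snd p)))))"
    by (simp add: gl_tree_adjoint of_nat_sum_mset sum_mset_distrib_left image_mset.compositionality comp_def case_prod_unfold ac_simps del: delta_simps)
  also have "\<dots> = (\<Sum>(P, R)\<in>#cop H. pr a P * pr b R)"
    by (simp add: sum_sum_mset case_prod_unfold pr_delta sum_product del: delta_simps)
  finally show ?thesis .
qed

section \<open>Degrees of forests and the functional of \<open>kappa\<close>\<close>

definition fsize :: "tree multiset \<Rightarrow> nat" where
  "fsize F = (\<Sum>t\<in>#F. tsize t)"

lemma fsize_simps [simp]:
  "fsize {#} = 0" "fsize (add_mset t F) = tsize t + fsize F" "fsize (F + G) = fsize F + fsize G"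
  by (simp_all add: fsize_def)

lemma tsize_Node: "tsize (Node F) = Suc (fsize F)"
  by (simp add: fsize_def)

declare tsize.simps [simp del] tsize_Node [simp]

text \<open>Every nonempty forest is a product of some B_+(K) and a forest H, both K and H having
  fewer vertices.\<close>

lemma forest_induct [case_names empty add]:
  assumes "P {#}" "\<And>K H. P K \<Longrightarrow> P H \<Longrightarrow> P (add_mset (Node K) H)"
  shows "P H"
proof (induction "fsize H" arbitrary: H rule: less_induct)
  case less
  show ?case
  proof (cases H)
    case empty
    with assms show ?thesis by simp
  next
    case (add t G)
    then show ?thesis using less assms(2) by (cases t) simp
  qed
qed

lemma fsize_eq_0 [simp]: "fsize F = 0 \<longleftrightarrow> F = {#}"
proof (cases F)
  case (add t G)
  then show ?thesis by (cases t) auto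
qed simp

text \<open>Needed for the finite support of \<open>kappa n\<close>, hence for evaluating its
  \<open>Abs_poly_mapping\<close>.\<close>

lemma finite_fsize: "finite {F. fsize F \<le> n}"
proof (induction n)
  case 0
  have "{F. fsize F \<le> 0} = {{#}}" by auto
  then show ?case by simp
next
  case (Suc n)
  let ?A = "{F. fsize F \<le> n}"
  have "{F. fsize F \<le> Suc n} \<subseteq> insert {#} ((\<lambda>(K, H). add_mset (Node K) H) ` (?A \<times> ?A))"
  proof
    fix F assume F: "F \<in> {F. fsize F \<le> Suc n}"
    show "F \<in> insert {#} ((\<lambda>(K, H). add_mset (Node K) H) ` (?A \<times> ?A))"
    proof (cases F)
      case (add t H)
      with F show ?thesis by (cases t) force
    qed simp
  qed
  then show ?case using Suc finite_subset by blast
qed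

lemma symc_nonzero: "symc t \<noteq> 0"
proof (induction t)
  case (Node F)
  then show ?case by (simp add: symc.simps)
qed

text \<open>The weight in the pairing cancels the denominator 1/|Sym(t)|, leaving the indicator of
  degree \<open>n\<close>.\<close>

lemma pr_kappa: "pr (kappa n :: 'k::field_char_0 kT) H = (if fsize H = n then 1 else 0)"
proof -
  have "{t. tsize t = n + 1} \<subseteq> Node ` {F. fsize F \<le> n}"
  proof
    fix t assume "t \<in> {t. tsize t = n + 1}"
    then show "t \<in> Node ` {F. fsize F \<le> n}" by (cases t) auto
  qed
  then have "finite {t. tsize t = n + 1}"
    using finite_fsize finite_surj by blast
  then have "finite {t. (if tsize t = n + 1 then 1 / of_nat (symc t) else 0 :: 'k) \<noteq> 0}"
    by (rule rev_finite_subset) auto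
  then show ?thesis
    by (simp add: pr_def kappa_def Abs_poly_mapping_inverse symc_nonzero)
qed

lemma cop_fsize: "(P, R) \<in># cop H \<Longrightarrow> fsize P + fsize R = fsize H"
proof (induction H arbitrary: P R rule: forest_induct)
  case (add K H)
  \<comment> \<open>\<open>cop_add\<close> speaks of sums only; membership is read off from a sum of
    singletons.\<close>
  have e: "cop (add_mset (Node K) H) = (\<Sum>p\<in>#cop (add_mset (Node K) H). {#p#})"
    by simp
  have "(P, R) \<in># (\<Sum>(P, R)\<in>#cop H. {#(add_mset (Node K) P, R)#})
      + (\<Sum>(P', R')\<in>#cop K. \<Sum>(P, R)\<in>#cop H. {#(P' + P, add_mset (Node R') R)#})"
    using add.prems unfolding e[unfolded cop_add] .
  then show ?case using add.IH by fastforce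
qed simp

lemma pr_sum: "pr (\<Sum>i\<in>S. f i) H = (\<Sum>i\<in>S. pr (f i) H)"
  by (simp add: pr_def lookup_sum sum_distrib_right)

lemma pr_scale [simp]: "pr (Poly_Mapping.map (\<lambda>x. c * x) a) H = c * pr a H"
  by (simp add: pr_def mult.assoc)

lemma pr_bullet [simp]: "pr (Poly_Mapping.single bullet 1) H = (if H = {#} then 1 else 0)"
  by (simp add: pr_def lookup_single when_def symc.simps)

section \<open>The functional dual to \<open>eps\<close>\<close>

abbreviation bullets :: "nat \<Rightarrow> tree multiset" where
  "bullets n \<equiv> replicate_mset n bullet"

lemma fsize_bullets [simp]: "fsize (bullets n) = n"
  by (induction n) auto

text \<open>Only the total cut of every component leaves nothing.\<close>

lemma cop_empty_trunk: "(\<Sum>(P, R)\<in>#cop H. if R = {#} then \<phi> P else 0) = \<phi> H"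
  for \<phi> :: "tree multiset \<Rightarrow> 'k::comm_ring_1"
proof (induction H arbitrary: \<phi> rule: forest_induct)
  case (add K H)
  then show ?case
    by (simp add: cop_add case_prod_unfold cong: if_cong)
qed simp

definition all_bullets :: "tree multiset \<Rightarrow> bool" where
  "all_bullets R \<longleftrightarrow> (\<forall>t\<in>#R. t = bullet)"

lemma all_bullets_simps [simp]:
  "all_bullets {#}"
  "all_bullets (add_mset t R) \<longleftrightarrow> t = bullet \<and> all_bullets R"
  by (auto simp: all_bullets_def)

lemma bullets_iff: "R = bullets n \<longleftrightarrow> all_bullets R \<and> fsize R = n"
proof -
  have "all_bullets R \<Longrightarrow> R = bullets (fsize R)" for R
    by (induction R) auto
  moreover have "all_bullets (bullets n)" for n
    by (induction n) auto
  ultimately show ?thesis by auto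
qed

text \<open>The vanishing is componentwise: the total cut of a component and the cuts leaving
  exactly its root contribute opposite signs.\<close>
lemma cop_alternating:
  "(\<Sum>(P, R)\<in>#cop H. if all_bullets R then (-1) ^ fsize P else 0) = (if H = {#} then 1 else (0::'k::comm_ring_1))"
proof (cases H)
  case (add t G)
  obtain K where t: "t = Node K" by (cases t)
  let ?S = "\<Sum>(P, R)\<in>#cop G. if all_bullets R then (-1) ^ fsize P else (0::'k)"
  have "(\<Sum>(P, R)\<in>#cop H. if all_bullets R then (-1) ^ fsize P else 0)
     = (-1) ^ Suc (fsize K) * ?S + (\<Sum>(P', R')\<in>#cop K. if R' = {#} then (-1) ^ fsize P' * ?S else 0)"
    unfolding add t cop_add
    by (auto simp: case_prod_unfold sum_mset_distrib_left power_add intro!: arg_cong2[where f="(+)"] arg_cong[of _ _ sum_mset] image_mset_cong)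
  also have "\<dots> = 0"
    \<comment> \<open>The second sum reduces to the total cut of \<open>K\<close>, which removes one
      vertex fewer than the total cut of \<open>t\<close>.\<close>
    by (subst cop_empty_trunk) simp
  finally show ?thesis using add by simp
qed (simp add: all_bullets_def)

text \<open>Only the cut that removes nothing has an empty pruned part.\<close>

lemma cop_empty_crown: "(\<Sum>(P, R)\<in>#cop H. if P = {#} then \<phi> R else 0) = \<phi> H"
  for \<phi> :: "tree multiset \<Rightarrow> 'k::comm_ring_1"
proof (induction H arbitrary: \<phi> rule: forest_induct)
  case (add K H)
  have "(\<Sum>(P, R)\<in>#cop (add_mset (Node K) H). if P = {#} then \<phi> R else 0)
      = (\<Sum>(P', R')\<in>#cop K. if P' = {#} then (\<Sum>(P, R)\<in>#cop H. if P = {#} then \<phi> (add_mset (Node R') R) else 0) else 0)"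
    by (auto simp: cop_add case_prod_unfold intro!: arg_cong[of _ _ sum_mset] image_mset_cong)
  then show ?case by (simp only: add)
qed simp

text \<open>The lists grow only at the end, so earlier entries never change.\<close>

lemma eps_list_nth: "i \<le> n \<Longrightarrow> eps_list n ! i = (eps i :: 'k::field_char_0 kT)"
proof -
  have len: "length (eps_list n :: 'k kT list) = Suc n" for n
    by (induction n) auto
  show "i \<le> n \<Longrightarrow> eps_list n ! i = (eps i :: 'k kT)"
  proof (induction n)
    case 0
    then show ?case by (simp add: eps_def)
  next
    case (Suc n)
    show ?case
    proof (cases "i = Suc n")
      case True
      then show ?thesis using len[of n] by (simp add: eps_def nth_append)
    next
      case False
      with Suc show ?thesis using len[of n] by (simp add: nth_append)
    qed
  qed
qed

lemma eps_Suc: "(eps (Suc n) :: 'k::field_char_0 kT) = (\<Sum>i\<in>{1..Suc n}. Poly_Mapping.map (\<lambda>x. (-1) ^ (i - 1) * x)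
                           (kappa i \<circ>\<^sub>G\<^sub>L eps (Suc n - i)))"
proof -
  have "(eps (Suc n) :: 'k kT) = (\<Sum>i\<in>{1..Suc n}. Poly_Mapping.map (\<lambda>x. (-1) ^ (i - 1) * x)
                           (kappa i \<circ>\<^sub>G\<^sub>L (eps_list n ! (Suc n - i))))"
    by (simp add: eps_def)
  also have "\<dots> = (\<Sum>i\<in>{1..Suc n}. Poly_Mapping.map (\<lambda>x. (-1) ^ (i - 1) * x)
                           (kappa i \<circ>\<^sub>G\<^sub>L eps (Suc n - i)))"
    by (intro sum.cong refl) (subst eps_list_nth, auto)
  finally show ?thesis .
qed

text \<open>Equivalently, eps n is the corolla with n leaves, divided by n!.\<close>
lemma pr_eps: "pr (eps n :: 'k::field_char_0 kT) H = (if H = bullets n then 1 else 0)"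
proof (induction n arbitrary: H rule: less_induct)
  case (less n)
  show ?case
  proof (cases n)
    case 0
    then show ?thesis by (simp add: eps_def)
  next
    case (Suc m)
    let ?g = "\<lambda>i (P, R). (-1) ^ (i - 1) * ((if fsize P = i then 1 else 0) * (if R = bullets (n - i) then 1 else 0 :: 'k))"
    have "pr (eps n :: 'k kT) H = (\<Sum>i\<in>{1..n}. \<Sum>p\<in>#cop H. ?g i p)"
      unfolding Suc eps_Suc pr_sum pr_scale pr_gl pr_kappa
      using less Suc by (auto intro!: sum.cong simp: sum_mset_distrib_left case_prod_unfold)
    also have "\<dots> = (\<Sum>p\<in>#cop H. \<Sum>i\<in>{1..n}. ?g i p)"
      by (rule sum_sum_mset)
    \<comment> \<open>Only \<open>i = fsize P\<close> survives. The sign (-1)^(i-1) is minus that of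
      the alternating sum, and the first term restores the index 0, which is absent from
      \<open>{1..n}\<close>.\<close>
    also have "\<dots> = (\<Sum>(P, R)\<in>#cop H. (if fsize H = n then
        (if fsize P = 0 then (if all_bullets R then 1 else 0) else 0) - (if all_bullets R then (-1) ^ fsize P else 0) else 0))"
    proof (intro arg_cong[of _ _ sum_mset] image_mset_cong)
      fix p assume p: "p \<in># cop H"
      obtain P R where PR: "p = (P, R)" by (cases p)
      have fs: "fsize P + fsize R = fsize H" using cop_fsize p PR by blast
      have "(\<Sum>i\<in>{1..n}. ?g i p) = (\<Sum>i\<in>{1..n}. if i = fsize P then (-1) ^ (fsize P - 1) * (if R = bullets (n - fsize P) then 1 else 0) else 0)"
        by (rule sum.cong) (auto simp: PR)
      also have "\<dots> = (if fsize P \<in> {1..n} then (-1) ^ (fsize P - 1) * (if R = bullets (n - fsize P) then 1 else 0) else 0)"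
        by (simp only: sum.delta finite_atLeastAtMost)
      also have "\<dots> = (if fsize H = n then
        (if fsize P = 0 then (if all_bullets R then 1 else 0) else 0) - (if all_bullets R then (-1) ^ fsize P else 0) else 0)"
        using fs by (cases "fsize P") (auto simp: bullets_iff)
      finally show "(\<Sum>i\<in>{1..n}. ?g i p) = (case p of (P, R) \<Rightarrow> (if fsize H = n then
        (if fsize P = 0 then (if all_bullets R then 1 else 0) else 0) - (if all_bullets R then (-1) ^ fsize P else 0) else 0))"
        by (simp add: PR)
    qed
    also have "\<dots> = (if H = bullets n then 1 else 0)"
    proof (cases "fsize H = n")
      case True
      \<comment> \<open>For nonempty \<open>H\<close> the alternating sum vanishes, and the uncut
        forest remains.\<close>
      then have "H \<noteq> {#}" using Suc by auto
      then have "(\<Sum>(P, R)\<in>#cop H. if all_bullets R then (-1) ^ fsize P else (0::'k)) = 0"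
        by (simp add: cop_alternating)
      moreover have "(\<Sum>(P, R)\<in>#cop H. if P = {#} then (if all_bullets R then 1 else 0) else (0::'k))
          = (if all_bullets H then 1 else 0)"
        by (rule cop_empty_crown)
      moreover have "(\<Sum>p\<in>#A. f p - g p) = sum_mset (image_mset f A) - sum_mset (image_mset g A)"
        for f g :: "_ \<Rightarrow> 'k" and A :: "(tree multiset \<times> tree multiset) multiset"
        by (induction A) auto
      ultimately show ?thesis using True by (simp add: case_prod_unfold bullets_iff)
    qed (auto simp: case_prod_unfold)
    finally show ?thesis .
  qed
qed

section \<open>Coefficients of \<open>Zstar\<close> by successive stripping of leaves\<close>

definition W :: "nat list \<Rightarrow> tree multiset \<Rightarrow> 'k::field_char_0" where
  "W I H = pr (Z_basis I) H"

lemma W_Nil [simp]: "W [] H = (if H = {#} then 1 else 0)"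
  by (simp add: W_def Z_basis_def)

lemma W_Cons: "W (i # I) H = (\<Sum>(P, R)\<in>#cop H. if P = bullets i then W I R else 0)"
  by (auto simp: W_def Z_basis_def pr_gl pr_eps intro!: arg_cong[of _ _ sum_mset] image_mset_cong)

lemma sum_mset_eq_0: "(\<And>x. x \<in># A \<Longrightarrow> f x = 0) \<Longrightarrow> (\<Sum>x\<in>#A. f x) = (0::'a::comm_monoid_add)"
  by (induction A) auto

text \<open>Cuts preserve the total degree and each step removes exactly \<open>i\<close> vertices;
  this yields the finite support needed to evaluate \<open>Zstar\<close>.\<close>

lemma W_degree: "sum_list I \<noteq> fsize H \<Longrightarrow> W I H = (0 :: 'a::field_char_0)"
proof (induction I arbitrary: H)
  case (Cons i I)
  show ?case unfolding W_Cons
  proof (intro sum_mset_eq_0, clarify)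
    fix P R assume "(P, R) \<in># cop H"
    then have "fsize P + fsize R = fsize H" by (rule cop_fsize)
    with Cons.prems Cons.IH[of R] show "(if P = bullets i then W I R else 0 :: 'a) = 0" by auto
  qed
qed auto

lemma composition_simps [simp]:
  "composition []" "composition (i # I) \<longleftrightarrow> 0 < i \<and> composition I"
  "composition (I @ J) \<longleftrightarrow> composition I \<and> composition J"
  by (auto simp: composition_def)

lemma finite_compositions: "finite {I. composition I \<and> sum_list I = n}"
proof -
  have "length I \<le> sum_list I" if "composition I" for I
    using that by (induction I) auto
  moreover have "x \<le> sum_list I" if "x \<in> set I" for x and I :: "nat list"
    using that by (induction I) auto
  ultimately have "{I. composition I \<and> sum_list I = n} \<subseteq> {I. set I \<subseteq> {..n} \<and> length I \<le> n}"
    by auto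
  then show ?thesis
    by (rule finite_subset) (simp add: finite_lists_length_le)
qed

lemma lookup_Zstar:
  "Poly_Mapping.lookup (Zstar v :: 'k::field_char_0 QSym) I
     = (if composition I then \<Sum>u\<in>Poly_Mapping.keys v. Poly_Mapping.lookup v u * W I u else 0)"
proof -
  have "{I. (if composition I then pairing (Z_basis I) v else 0 :: 'k) \<noteq> 0}
     \<subseteq> (\<Union>u\<in>Poly_Mapping.keys v. {I. composition I \<and> sum_list I = fsize u})"
  proof (rule subsetI, rule ccontr)
    fix I assume I: "I \<in> {I. (if composition I then pairing (Z_basis I) v else 0 :: 'k) \<noteq> 0}"
      and "I \<notin> (\<Union>u\<in>Poly_Mapping.keys v. {I. composition I \<and> sum_list I = fsize u})"
    then have "\<forall>u\<in>Poly_Mapping.keys v. pr (Z_basis I) u = (0 :: 'k)"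
      using W_degree[of I, where 'a = 'k] by (auto simp: W_def split: if_splits)
    with I show False by (auto simp: pairing_pr split: if_splits)
  qed
  then have "finite {I. (if composition I then pairing (Z_basis I) v else 0 :: 'k) \<noteq> 0}"
    by (rule finite_subset) (auto simp: finite_compositions)
  then show ?thesis
    by (simp add: Zstar_def Abs_poly_mapping_inverse pairing_pr W_def)
qed

lemma lookup_Zstar_single [simp]:
  "Poly_Mapping.lookup (Zstar (Poly_Mapping.single u 1) :: 'k::field_char_0 QSym) I = (if composition I then W I u else 0)"
  by (simp add: lookup_Zstar)

section \<open>The recursion for B_+\<close>

lemma cop_single: "(\<Sum>p\<in>#cop {#Node K#}. f p) = f ({#Node K#}, {#}) + (\<Sum>(P, R)\<in>#cop K. f (P, {#Node R#}))"
  for f :: "tree multiset \<times> tree multiset \<Rightarrow> 'b::comm_monoid_add"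
  by (simp add: cop_add)

text \<open>The root can be stripped only when nothing lies above it, hence alone and last. Until
  then every cut of \<open>Node K\<close> is a cut of \<open>K\<close> with the root kept.\<close>

lemma W_B_plus:
  "composition I \<Longrightarrow> W I {#Node K#} = (if I \<noteq> [] \<and> last I = 1 then W (butlast I) K else (0 :: 'a::field_char_0))"
proof (induction I arbitrary: K)
  case (Cons i I)
  show ?case
  proof (cases I)
    case Nil
    have "{#Node K#} = bullets i \<longleftrightarrow> K = {#} \<and> i = 1"
      by (auto simp: bullets_iff)
    with Nil show ?thesis by (simp add: W_Cons cop_single case_prod_unfold cong: if_cong)
  next
    case (Cons j J)
    \<comment> \<open>A positive part cannot be stripped from the empty forest, so the total cut
      drops out when further parts follow.\<close>
    then have "W I {#} = (0 :: 'a)" using Cons.prems by (simp add: W_Cons)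
    then have "W (i # I) {#Node K#} = (\<Sum>(P, R)\<in>#cop K. if P = bullets i then W I {#Node R#} else 0 :: 'a)"
      by (simp add: W_Cons[of i] cop_single)
    with Cons Cons.IH Cons.prems show ?thesis
      by (auto simp: W_Cons case_prod_unfold cong: if_cong)
  qed
qed simp

lemma lookup_alpha_plus:
  "Poly_Mapping.lookup (alpha_plus a) I = (if I \<noteq> [] \<and> last I = 1 then Poly_Mapping.lookup a (butlast I) else 0)"
proof (cases "I \<noteq> [] \<and> last I = 1")
  case True
  then have e: "J @ [1] = I \<longleftrightarrow> J = butlast I" for J
    by (metis append_butlast_last_id butlast_snoc)
  have "Poly_Mapping.lookup (alpha_plus a) I = (\<Sum>J\<in>Poly_Mapping.keys a. if J = butlast I then Poly_Mapping.lookup a J else 0)"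
    by (simp add: alpha_plus_def lookup_sum lookup_single when_def e del: One_nat_def)
  then show ?thesis using True by (auto simp: in_keys_iff)
next
  case False
  then have "J @ [1] \<noteq> I" for J by auto
  with False show ?thesis
    by (auto simp: alpha_plus_def lookup_sum lookup_single when_def)
qed

theorem Zstar_B_plus:
  "(Zstar (Poly_Mapping.single {#Node u#} 1) :: 'k::field_char_0 QSym) = alpha_plus (Zstar (Poly_Mapping.single u 1))"
proof (rule poly_mapping_eqI)
  fix I :: "nat list"
  have "composition I \<longleftrightarrow> composition (butlast I) \<and> 0 < last I" if "I \<noteq> []"
    using that by (cases I rule: rev_cases) auto
  then show "Poly_Mapping.lookup (Zstar (Poly_Mapping.single {#Node u#} 1) :: 'k QSym) I
      = Poly_Mapping.lookup (alpha_plus (Zstar (Poly_Mapping.single u 1))) I"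
    by (auto simp: lookup_alpha_plus W_B_plus)
qed

section \<open>Disjoint unions and the quasi-shuffle product\<close>

lemma cop_union:
  fixes f :: "tree multiset \<times> tree multiset \<Rightarrow> 'b::comm_monoid_add"
  shows "(\<Sum>p\<in>#cop (H + H'). f p) = (\<Sum>(P, R)\<in>#cop H. \<Sum>(P', R')\<in>#cop H'. f (P + P', R + R'))"
proof (induction H arbitrary: f rule: forest_induct)
  case (add K H)
  show ?case
    by (simp add: cop_add add.IH(2) case_prod_unfold add.assoc)
qed simp

text \<open>The pairs of compositions in which K occurs as a quasi-shuffle: the coproduct of
  the monomial in NSym indexed by K.\<close>
fun unshuffles :: "nat list \<Rightarrow> (nat list \<times> nat list) multiset" where
  "unshuffles [] = {#([], [])#}"
| "unshuffles (k # K) = (\<Sum>(I, J)\<in>#unshuffles K. {#(k # I, J), (I, k # J)#}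
      + (\<Sum>i\<in>#mset_set {1..<k}. {#(i # I, (k - i) # J)#}))"

text \<open>A zero part is a step in which this forest loses nothing; it allows a uniform sum over
  \<open>i\<close> from 0 to \<open>k\<close>.\<close>

lemma W_zero_part [simp]: "W (0 # I) H = W I H"
  using cop_empty_crown[of "\<lambda>R. W I R" H] by (simp add: W_Cons)

text \<open>Stripping \<open>k\<close> leaves from \<open>H + H'\<close> means stripping
  \<open>i\<close> from \<open>H\<close> and \<open>k - i\<close> from \<open>H'\<close> for some
  \<open>i\<close>.\<close>

lemma W_union:
  "composition K \<Longrightarrow> W K (H + H') = (\<Sum>(I, J)\<in>#unshuffles K. W I H * W J H' :: 'a::field_char_0)"
proof (induction K arbitrary: H H')
  case (Cons k K)
  have bul: "(if P + P' = bullets k then 1 else 0 :: 'a)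
     = (\<Sum>i\<in>{0..k}. (if P = bullets i then 1 else 0) * (if P' = bullets (k - i) then 1 else 0))" for P P'
  proof -
    have "all_bullets (P + P') \<longleftrightarrow> all_bullets P \<and> all_bullets P'"
      by (auto simp: all_bullets_def)
    then have "(if P + P' = bullets k then 1 else 0 :: 'a)
       = (\<Sum>i\<in>{0..k}. if i = fsize P then (if all_bullets P \<and> all_bullets P' \<and> fsize P' = k - fsize P then 1 else 0) else 0)"
      by (auto simp: bullets_iff)
    also have "\<dots> = (\<Sum>i\<in>{0..k}. (if P = bullets i then 1 else 0) * (if P' = bullets (k - i) then 1 else 0))"
      by (intro sum.cong refl) (auto simp: bullets_iff)
    finally show ?thesis .
  qed
  let ?c = "\<lambda>P i. if P = bullets i then 1 else 0 :: 'a"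
  have Wc: "(W (i # I) H :: 'a) = (\<Sum>p\<in>#cop H. ?c (fst p) i * W I (snd p))" for i I H
    by (auto simp: W_Cons intro!: arg_cong[of _ _ sum_mset] image_mset_cong)
  have K: "composition K" "0 < k" using Cons.prems by auto
  have "W (k # K) (H + H') = (\<Sum>p\<in>#cop H. \<Sum>q\<in>#cop H'. ?c (fst p + fst q) k * W K (snd p + snd q))"
    by (simp add: Wc cop_union case_prod_unfold)
  also have "\<dots> = (\<Sum>p\<in>#cop H. \<Sum>q\<in>#cop H'. \<Sum>IJ\<in>#unshuffles K. \<Sum>i\<in>{0..k}.
       (?c (fst p) i * W (fst IJ) (snd p)) * (?c (fst q) (k - i) * W (snd IJ) (snd q)))"
    unfolding bul Cons.IH[OF K(1)] case_prod_unfold sum_distrib_right sum_mset_distrib_left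
    by (simp only: sum_sum_mset sum_mset_distrib_left ac_simps)
  also have "\<dots> = (\<Sum>IJ\<in>#unshuffles K. \<Sum>i\<in>{0..k}. W (i # fst IJ) H * W ((k - i) # snd IJ) H')"
    unfolding Wc
    by (simp add: sum_mset_distrib_left sum_mset_distrib_right sum_sum_mset sum_mset.swap[of _ "cop _" "unshuffles K"]
       sum_mset.swap[of _ "cop H'" "cop H"])
  also have "\<dots> = (\<Sum>(I, J)\<in>#unshuffles (k # K). W I H * W J H')"
  proof -
    \<comment> \<open>The end points, distinct since \<open>k > 0\<close>, give a zero part on one
      side and thus the first two pairs of \<open>unshuffles\<close>.\<close>
    have "{0..k} = insert 0 (insert k {1..<k})" using K by auto
    then have "(\<Sum>i\<in>{0..k}. f i) = f 0 + f k + (\<Sum>i\<in>{1..<k}. f i)" for f :: "nat \<Rightarrow> 'a"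
      using K by simp
    then show ?thesis
      by (simp add: sum_mset_UN case_prod_unfold ac_simps image_mset.compositionality comp_def flip: sum_unfold_sum_mset)
  qed
  finally show ?case .
qed simp

lemma qsh_Nil_right [simp]: "qsh I [] = {#I#}"
  by (cases I) auto

lemma count_image_Cons: "count (image_mset (Cons i) A) (k # K) = (if i = k then count A K else 0)"
  by (induction A) auto

lemma count_sum_mset_image: "count (\<Sum>p\<in>#A. g p) x = (\<Sum>p\<in>#A. count (g p) x)"
  by (induction A) auto

lemma qsh_composition:
  "K \<in># qsh I J \<Longrightarrow> composition I \<Longrightarrow> composition J \<Longrightarrow> composition K"
proof (induction I J arbitrary: K rule: qsh.induct)
  case (3 i I j J)
  from "3.prems"(1) show ?case
    by (simp, elim disjE imageE) (use 3 in simp_all)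
qed simp_all

text \<open>Duality between the product of QSym and the coproduct of NSym: the first part of
  \<open>K\<close> comes from \<open>I\<close>, from \<open>J\<close>, or is the sum of both first
  parts.\<close>

lemma count_unshuffles:
  assumes "composition K" "composition I" "composition J"
  shows "count (unshuffles K) (I, J) = count (qsh I J) K"
  using assms
proof (induction K arbitrary: I J)
  case Nil
  show ?case
  proof (cases "I = [] \<or> J = []")
    case True
    then show ?thesis by auto
  next
    case False
    then show ?thesis
      by (cases I; cases J) (auto simp: count_eq_zero_iff simp del: count_greater_zero_iff)
  qed
next
  case (Cons k K)
  have count_eq: "(\<Sum>p\<in>#A. if p = q then c else 0) = count A q * c" for A :: "(nat list \<times> nat list) multiset" and q c
    using sum_mset_delta_eq[of q "\<lambda>_. c" A] by (simp add: eq_commute cong: if_cong)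
  show ?case
  proof (cases "I = [] \<or> J = []")
    case True
    \<comment> \<open>Splitting \<open>k\<close> yields two nonempty lists, which is impossible if
      \<open>I\<close> or \<open>J\<close> is empty.\<close>
    then have a: "count (\<Sum>l\<in>#mset_set {1..<k}. {#(l # fst p, (k - l) # snd p)#}) (I, J) = 0" for p
      by (auto simp: count_eq_zero_iff)
    have "count (unshuffles (k # K)) (I, J) = (\<Sum>p\<in>#unshuffles K.
         (if p = (tl I, J) then (if I \<noteq> [] \<and> hd I = k then 1 else 0) else 0)
         + (if p = (I, tl J) then (if J \<noteq> [] \<and> hd J = k then 1 else 0) else 0))"
      unfolding unshuffles.simps count_sum_mset_image[of _ "unshuffles K"] case_prod_unfold count_union a
      by (rule sum_mset_cong) (use True in \<open>cases I; cases J; auto\<close>)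
    also have "\<dots> = count (unshuffles K) (tl I, J) * (if I \<noteq> [] \<and> hd I = k then 1 else 0)
       + count (unshuffles K) (I, tl J) * (if J \<noteq> [] \<and> hd J = k then 1 else 0)"
      by (simp only: sum_mset.distrib count_eq)
    finally show ?thesis
      using True Cons.prems by (cases I; cases J) (auto simp: Cons.IH)
  next
    case False
    then obtain i I' j J' where IJ: "I = i # I'" "J = j # J'" by (metis neq_Nil_conv)
    have a: "count (\<Sum>l\<in>#mset_set {1..<k}. {#(l # fst p, (k - l) # snd p)#}) (I, J)
        = (if p = (I', J') then (if i + j = k then 1 else 0) else 0)" for p
    proof -
      have "count (\<Sum>l\<in>#mset_set {1..<k}. {#(l # fst p, (k - l) # snd p)#}) (I, J)
         = (\<Sum>l\<in>{1..<k}. if l = i then (if p = (I', J') \<and> k - i = j then 1 else 0) else 0)"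
        unfolding count_sum_mset_image unfolding sum_unfold_sum_mset[symmetric]
        by (rule sum.cong) (auto simp: IJ)
      also have "\<dots> = (if p = (I', J') then (if i + j = k then 1 else 0) else 0)"
        \<comment> \<open>Since \<open>i\<close> and \<open>j\<close> are positive,
          \<open>i + j = k\<close> says exactly that \<open>i\<close> lies in \<open>{1..<k}\<close>
          and \<open>k - i = j\<close>.\<close>
        using Cons.prems IJ by auto
      finally show ?thesis .
    qed
    have "count (unshuffles (k # K)) (I, J) = (\<Sum>p\<in>#unshuffles K.
         (if p = (I', J) then (if i = k then 1 else 0) else 0)
         + (if p = (I, J') then (if j = k then 1 else 0) else 0)
         + (if p = (I', J') then (if i + j = k then 1 else 0) else 0))"
      unfolding unshuffles.simps count_sum_mset_image[of _ "unshuffles K"] case_prod_unfold count_union a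
      by (rule sum_mset_cong) (auto simp: IJ)
    also have "\<dots> = count (unshuffles K) (I', J) * (if i = k then 1 else 0)
       + count (unshuffles K) (I, J') * (if j = k then 1 else 0)
       + count (unshuffles K) (I', J') * (if i + j = k then 1 else 0)"
      by (simp only: sum_mset.distrib count_eq)
    finally show ?thesis
      using Cons.prems by (simp add: IJ Cons.IH count_image_Cons)
  qed
qed

lemma sum_mset_eq_sum_count:
  assumes "finite S" "\<And>x. x \<notin> S \<Longrightarrow> f x = 0"
  shows "(\<Sum>x\<in>#A. f x) = (\<Sum>x\<in>S. of_nat (count A x) * (f x :: 'a::semiring_1))"
proof (induction A)
  case (add a A)
  have "(\<Sum>x\<in>S. of_nat (count (add_mset a A) x) * f x)
      = (\<Sum>x\<in>S. (if x = a then f a else 0) + of_nat (count A x) * f x)"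
    by (rule sum.cong) (auto simp: algebra_simps)
  also have "\<dots> = f a + (\<Sum>x\<in>S. of_nat (count A x) * f x)"
    using assms by (simp add: sum.distrib)
  finally show ?case using add by simp
qed simp

text \<open>Transposes the definition: instead of expanding all products, the coefficient at
  \<open>K\<close> collects the pairs that yield \<open>K\<close>, which is the form met in
  \<open>W_union\<close>.\<close>

lemma lookup_qmult:
  fixes a b :: "'k::comm_ring_1 QSym"
  assumes "qsym_elem a" "qsym_elem b"
  shows "Poly_Mapping.lookup (qmult a b) K
    = (if composition K then \<Sum>(I, J)\<in>#unshuffles K. Poly_Mapping.lookup a I * Poly_Mapping.lookup b J else 0)"
proof -
  have zero: "count (qsh I J) K = 0" if "\<not> composition K" "I \<in> Poly_Mapping.keys a" "J \<in> Poly_Mapping.keys b" for I J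
    using assms that qsh_composition by (auto simp: qsym_elem_def count_eq_zero_iff)
  have "Poly_Mapping.lookup (qmult a b) K = (\<Sum>I\<in>Poly_Mapping.keys a. \<Sum>J\<in>Poly_Mapping.keys b.
     Poly_Mapping.lookup a I * Poly_Mapping.lookup b J * of_nat (count (qsh I J) K))"
    by (simp add: qmult_def lookup_sum)
  also have "\<dots> = (\<Sum>(I, J)\<in>Poly_Mapping.keys a \<times> Poly_Mapping.keys b.
     of_nat (if composition K then count (unshuffles K) (I, J) else 0) * (Poly_Mapping.lookup a I * Poly_Mapping.lookup b J))"
    using assms unfolding sum.cartesian_product
    by (intro sum.cong) (auto simp: count_unshuffles qsym_elem_def zero)
  also have "\<dots> = (if composition K then \<Sum>(I, J)\<in>#unshuffles K. Poly_Mapping.lookup a I * Poly_Mapping.lookup b J else 0)"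
  proof -
    have "(\<Sum>(I, J)\<in>#unshuffles K. Poly_Mapping.lookup a I * Poly_Mapping.lookup b J)
      = (\<Sum>p\<in>Poly_Mapping.keys a \<times> Poly_Mapping.keys b.
          of_nat (count (unshuffles K) p) * (case p of (I, J) \<Rightarrow> Poly_Mapping.lookup a I * Poly_Mapping.lookup b J))"
      by (rule sum_mset_eq_sum_count) (auto simp: in_keys_iff)
    then show ?thesis by (simp add: case_prod_unfold)
  qed
  finally show ?thesis .
qed

lemma qsym_elem_Zstar: "qsym_elem (Zstar v :: 'k::field_char_0 QSym)"
  by (auto simp: qsym_elem_def in_keys_iff lookup_Zstar split: if_splits)

lemma unshuffles_composition:
  "(I, J) \<in># unshuffles K \<Longrightarrow> composition K \<Longrightarrow> composition I \<and> composition J"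
  by (induction K arbitrary: I J) force+

lemma Zstar_union:
  "(Zstar (Poly_Mapping.single (H + H') 1) :: 'k::field_char_0 QSym)
     = qmult (Zstar (Poly_Mapping.single H 1)) (Zstar (Poly_Mapping.single H' 1))"
proof (rule poly_mapping_eqI)
  fix K
  show "Poly_Mapping.lookup (Zstar (Poly_Mapping.single (H + H') 1) :: 'k QSym) K
    = Poly_Mapping.lookup (qmult (Zstar (Poly_Mapping.single H 1)) (Zstar (Poly_Mapping.single H' 1))) K"
    by (auto simp: lookup_qmult[OF qsym_elem_Zstar qsym_elem_Zstar] W_union
      dest: unshuffles_composition intro!: sum_mset_cong)
qed

lemma Zstar_one: "(Zstar (Poly_Mapping.single {#} 1) :: 'k::field_char_0 QSym) = qone"
proof (rule poly_mapping_eqI)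
  fix I
  have "composition I \<Longrightarrow> W I {#} = (if I = [] then 1 else (0 :: 'k))"
    by (cases I) (auto simp: W_Cons)
  then show "Poly_Mapping.lookup (Zstar (Poly_Mapping.single {#} 1) :: 'k QSym) I = Poly_Mapping.lookup qone I"
    by (subst lookup_Zstar_single) (auto simp: qone_def M_def lookup_single when_def)
qed

section \<open>Uniqueness\<close>

lemma alg_hom_eq_Zstar:
  fixes f :: "'k::field_char_0 HK \<Rightarrow> 'k QSym"
  assumes f: "alg_hom_HK_QSym f"
    and B: "\<And>u. f (Poly_Mapping.single {#Node u#} 1) = alpha_plus (f (Poly_Mapping.single u 1))"
  shows "f = Zstar"
proof
  fix x :: "'k HK"
  have f_add: "f (y + z) = f y + f z" and f_mult: "f (y * z) = qmult (f y) (f z)"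
    and f_one: "f 1 = qone" for y z
    using f by (auto simp only: alg_hom_HK_QSym_def)
  have f_scale: "f (Poly_Mapping.map (\<lambda>z. c * z) y) = Poly_Mapping.map (\<lambda>z. c * z) (f y)" for c y
    using f by (simp only: alg_hom_HK_QSym_def)
  have mono: "f (Poly_Mapping.single u 1) = Zstar (Poly_Mapping.single u 1)" for u
  proof (induction u rule: forest_induct)
    case empty
    have "f (Poly_Mapping.single {#} 1) = qone"
      by (simp add: f_one)
    then show ?case by (simp only: Zstar_one)
  next
    case (add K H)
    have "Poly_Mapping.single (add_mset (Node K) H) (1::'k)
        = Poly_Mapping.single {#Node K#} 1 * Poly_Mapping.single H 1"
      by (simp add: mult_single)
    then have "f (Poly_Mapping.single (add_mset (Node K) H) 1)
        = qmult (f (Poly_Mapping.single {#Node K#} 1)) (f (Poly_Mapping.single H 1))"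
      by (simp only: f_mult)
    also have "\<dots> = Zstar (Poly_Mapping.single ({#Node K#} + H) 1)"
      by (simp only: B add Zstar_union Zstar_B_plus)
    finally show ?case by simp
  qed
  have single: "Poly_Mapping.single u c = Poly_Mapping.map (\<lambda>z. c * z) (Poly_Mapping.single u 1)" for u and c :: 'k
    by (rule poly_mapping_eqI) (simp add: lookup_single when_def)
  have monomials: "(\<Sum>u\<in>Poly_Mapping.keys x. Poly_Mapping.single u (Poly_Mapping.lookup x u)) = x"
    by (rule poly_mapping_eqI) (simp add: lookup_sum lookup_single when_def in_keys_iff)
  have "f (\<Sum>u\<in>S. Poly_Mapping.single u (c u)) = (\<Sum>u\<in>S. f (Poly_Mapping.single u (c u)))" if "finite S" for S c
    using that
  proof (induction S)
    case empty
    \<comment> \<open>Cancellation gives \<open>f 0 = 0\<close>.\<close>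
    have "f 0 = f 0 + f 0"
      using f_add[of 0 0] by simp
    then show ?case by simp
  next
    case (insert u S)
    then show ?case by (simp add: f_add)
  qed
  from this[OF finite_keys, of "Poly_Mapping.lookup x" x] have "f x = (\<Sum>u\<in>Poly_Mapping.keys x. f (Poly_Mapping.single u (Poly_Mapping.lookup x u)))"
    by (simp only: monomials)
  also have "\<dots> = (\<Sum>u\<in>Poly_Mapping.keys x. Poly_Mapping.map (\<lambda>z. Poly_Mapping.lookup x u * z) (Zstar (Poly_Mapping.single u 1)))"
    by (intro sum.cong refl) (subst single, simp only: f_scale mono)
  also have "\<dots> = Zstar x"
    by (rule poly_mapping_eqI) (simp add: lookup_sum lookup_Zstar)
  finally show "f x = Zstar x" .
qed

theorem theorem4p2:
  fixes dummy :: "'k::field_char_0"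
  shows "(\<forall>u :: tree multiset.
            (Zstar (Poly_Mapping.single {#Node u#} 1) :: 'k QSym)
              = alpha_plus (Zstar (Poly_Mapping.single u 1)))
       \<and> (\<forall>f :: 'k HK \<Rightarrow> 'k QSym.
            alg_hom_HK_QSym f \<and>
            (\<forall>u :: tree multiset. f (Poly_Mapping.single {#Node u#} 1)
                                   = alpha_plus (f (Poly_Mapping.single u 1)))
            \<longrightarrow> f = Zstar)"
  by (auto simp: Zstar_B_plus intro: alg_hom_eq_Zstar)

end
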